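(* Let $f$ be a $g$-convex function on the interval $J$ and put $h=g\circ f$. Then for all $a<b$ in $J$, $$\begin{aligned} f\left(\frac{a+b}{2}\right)&\le \int_0^1 g^{-1}\left(\frac{h((1-v)a+vb)+h((1-v)b+va)}{2}\right)dv\\ &\le \int_0^1 f((1-v)a+vb)\,dv\\ &\le \frac12\left(\int_0^1 g^{-1}\big((1-v)h(a)+vh(b)\big)dv+\int_0^1 g^{-1}\big((1-v)h(b)+vh(a)\big)dv\right)\\ &\le \frac{f(a)+f(b)}{2}.\end{aligned}$$
   Context: Let $J,J_2,J_3\subseteq\mathbb{R}$ be intervals. A continuous function $f:J\to J_2$ is called $g$-convex on $J$ if $g:J_2\to J_3$ is (strictly) increasing and concave on $J_2$ and $g\circ f:J\to J_3$ is convex. $g^{-1}$ denotes the inverse of $g$, defined on $g(J_2)$. *)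

theory Defs
  imports "HOL-Analysis.Analysis"
begin

text \<open>
  Continuity of \<open>g\<close> is not assumed: a concave increasing function may jump at the left
  endpoint of \<open>J2\<close>, in which case \<open>g ` J2\<close> is not an interval.
\<close>

definition g_convex_on ::
  "real set \<Rightarrow> real set \<Rightarrow> real set \<Rightarrow> (real \<Rightarrow> real) \<Rightarrow> (real \<Rightarrow> real) \<Rightarrow> bool" where
  "g_convex_on J J2 J3 g f \<longleftrightarrow>
     is_interval J \<and> is_interval J2 \<and> is_interval J3 \<and>
     f ` J \<subseteq> J2 \<and> continuous_on J f \<and>
     g ` J2 \<subseteq> J3 \<and> strict_mono_on J2 g \<and> concave_on J2 g \<and>
     convex_on J (g \<circ> f)"

end

(*
A convex function on an interval is upper semicontinuous, also at endpoints.  Hence h is upper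
semicontinuous, while g (concave) is lower semicontinuous, and so is h = g o f.  Thus h is
continuous, although g need not be, and the image of [a,b] under h is a compact interval inside
the image of g, on which the inverse of g is continuous, because its composition with the
quotient map h is f.  The four inequalities then hold pointwise after averaging over
v and 1 - v, by monotonicity and convexity of the inverse of g.
*)
theory Submission
  imports Defs
begin

text \<open>Between \<open>x0\<close> and another point \<open>y\<close> of \<open>S\<close> the
  graph lies below the chord, which tends to \<open>\<phi> x0\<close> at \<open>x0\<close>. One
  chord on each side suffices, and a side without points of \<open>S\<close> is trivial, so
  endpoints are covered.\<close>

lemma convex_on_interval_upper_semicontinuous:
  fixes \<phi> :: "real \<Rightarrow> real"
  assumes cv: "convex_on S \<phi>" and x0: "x0 \<in> S" and c: "\<phi> x0 < c"
  shows "\<forall>\<^sub>F x in nhds x0. x \<in> S \<longrightarrow> \<phi> x < c"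
proof -
  have chord: "\<forall>\<^sub>F x in nhds x0. x \<in> closed_segment x0 y \<longrightarrow> \<phi> x < c" if y: "y \<in> S" "y \<noteq> x0" for y
  proof -
    \<comment> \<open>\<open>L\<close> is the affine interpolation through \<open>x0\<close> and
      \<open>y\<close>; its parameter \<open>(x - x0) / (y - x0)\<close> recovers the
      \<open>u\<close> of \<open>closed_segment\<close>.\<close>
    define L where "L x = (1 - (x - x0) / (y - x0)) * \<phi> x0 + (x - x0) / (y - x0) * \<phi> y" for x
    have "isCont L x0" unfolding L_def using y by (intro continuous_intros) auto
    then have "(L \<longlongrightarrow> L x0) (nhds x0)"
      by (simp add: isCont_def tendsto_at_iff_tendsto_nhds)
    then have "(L \<longlongrightarrow> \<phi> x0) (nhds x0)" by (simp add: L_def)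
    then have "\<forall>\<^sub>F x in nhds x0. L x < c" using c by (rule order_tendstoD)
    moreover have "\<phi> x \<le> L x" if "x \<in> closed_segment x0 y" for x
    proof -
      obtain u where u: "0 \<le> u" "u \<le> 1" "x = (1 - u) * x0 + u * y"
        using \<open>x \<in> closed_segment x0 y\<close> by (auto simp: closed_segment_def)
      have "(x - x0) / (y - x0) = u" using y u by (simp add: field_simps)
      then show ?thesis using convex_onD[OF cv u(1,2) x0 y(1)] u by (simp add: L_def)
    qed
    ultimately show ?thesis by (auto elim!: eventually_mono intro: le_less_trans)
  qed
  have right: "\<forall>\<^sub>F x in nhds x0. x \<in> S \<longrightarrow> x0 \<le> x \<longrightarrow> \<phi> x < c"
  proof (cases "\<exists>y\<in>S. x0 < y")
    case True
    then obtain y where y: "y \<in> S" "x0 < y" by blast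
    then have "\<forall>\<^sub>F x in nhds x0. x < y"
      by (intro order_tendstoD[OF filterlim_ident])
    with chord[OF y(1)] y show ?thesis
      by (auto simp: closed_segment_eq_real_ivl elim: eventually_elim2)
  next
    \<comment> \<open>With no point of \<open>S\<close> to the right of \<open>x0\<close>, only
      \<open>x = x0\<close> is left, where the bound is the assumption on \<open>c\<close>.\<close>
    case False
    then show ?thesis using c by (intro always_eventually) force
  qed
  have left: "\<forall>\<^sub>F x in nhds x0. x \<in> S \<longrightarrow> x \<le> x0 \<longrightarrow> \<phi> x < c"
  proof (cases "\<exists>y\<in>S. y < x0")
    case True
    then obtain y where y: "y \<in> S" "y < x0" by blast
    then have "\<forall>\<^sub>F x in nhds x0. y < x"
      by (intro order_tendstoD[OF filterlim_ident])
    with chord[OF y(1)] y show ?thesis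
      by (auto simp: closed_segment_eq_real_ivl elim: eventually_elim2)
  next
    case False
    then show ?thesis using c by (intro always_eventually) force
  qed
  show ?thesis using left right by eventually_elim auto
qed

text \<open>Lower bounds pass from \<open>g\<close> to \<open>g \<circ> f\<close> along the
  continuous \<open>f\<close>, since concavity makes \<open>g\<close> lower semicontinuous; upper
  bounds come from convexity of \<open>g \<circ> f\<close> itself.\<close>

lemma continuous_on_compose_g_convex:
  assumes "g_convex_on J J2 J3 g f"
  shows "continuous_on J (g \<circ> f)"
  unfolding continuous_on_def
proof (intro ballI order_tendstoI)
  fix x c assume x: "x \<in> J"
  have maps: "f ` J \<subseteq> J2" and contf: "continuous_on J f"
    and cv: "convex_on J (g \<circ> f)" and cc: "convex_on J2 (\<lambda>y. - g y)"
    using assms by (auto simp: g_convex_on_def concave_on_def)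
  {
    assume "c < (g \<circ> f) x"
    \<comment> \<open>The lower bound on \<open>g\<close> is an upper bound on the convex function
      \<open>- g\<close>, taken at the point \<open>f x\<close>.\<close>
    then have "\<forall>\<^sub>F y in nhds (f x). y \<in> J2 \<longrightarrow> - g y < - c"
      using x maps by (intro convex_on_interval_upper_semicontinuous[OF cc]) auto
    moreover have "filterlim f (nhds (f x)) (at x within J)"
      using contf x by (simp add: continuous_on_def)
    ultimately have "\<forall>\<^sub>F z in at x within J. f z \<in> J2 \<longrightarrow> - g (f z) < - c"
      by (rule eventually_compose_filterlim)
    then show "\<forall>\<^sub>F z in at x within J. c < (g \<circ> f) z"
      using maps by (auto simp: eventually_at_filter elim!: eventually_mono)
  next
    assume "(g \<circ> f) x < c"
    then have "\<forall>\<^sub>F z in nhds x. z \<in> J \<longrightarrow> (g \<circ> f) z < c"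
      by (rule convex_on_interval_upper_semicontinuous[OF cv x])
    then show "\<forall>\<^sub>F z in at x within J. (g \<circ> f) z < c"
      by (auto simp: eventually_at_filter elim!: eventually_mono)
  }
qed

text \<open>The preimage of a closed \<open>B\<close> under \<open>k\<close> is the
  \<open>h\<close>-image of its preimage under \<open>k \<circ> h\<close>; that image is compact,
  hence closed in a Hausdorff space. With \<open>k\<close> the inverse of \<open>g\<close>, this
  bypasses any jump of \<open>g\<close>.\<close>

lemma continuous_on_factor_compact:
  fixes h :: "'a::topological_space \<Rightarrow> 'b::t2_space" and k :: "'b \<Rightarrow> 'c::topological_space"
  assumes "compact S" and h: "continuous_on S h" and kh: "continuous_on S (k \<circ> h)"
  shows "continuous_on (h ` S) k"
  unfolding continuous_on_closed_invariant
proof (intro allI impI)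
  fix B :: "'c set" assume "closed B"
  then obtain C where C: "closed C" "C \<inter> S = (k \<circ> h) -` B \<inter> S"
    using kh unfolding continuous_on_closed_invariant by blast
  have "compact (h ` (C \<inter> S))"
    using C(1) assms(1) h by (intro compact_continuous_image)
      (auto intro: continuous_on_subset closed_Int_compact)
  then have "closed (h ` (C \<inter> S))" by (rule compact_imp_closed)
  moreover have "h ` (C \<inter> S) \<inter> h ` S = k -` B \<inter> h ` S"
    unfolding C(2) by auto
  ultimately show "\<exists>A. closed A \<and> A \<inter> h ` S = k -` B \<inter> h ` S" by blast
qed

text \<open>Reflection at 0 followed by a shift. It serves to merge the two halves of a symmetrised
  integrand.\<close>

lemma integral_reflect_unit:
  fixes F :: "real \<Rightarrow> real"
  shows "integral {0..1} (\<lambda>v. F (1 - v)) = integral {0..1} F"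
proof -
  have "integral {0..1} F = integral {-1..0} (\<lambda>v. F (- v))"
    using Henstock_Kurzweil_Integration.integral_reflect_real[of 1 0 F] by simp
  also have "\<dots> = integral {0..1} ((\<lambda>v. F (- v)) \<circ> (+) (- 1))"
    using integral_shift_Icc_real[of 0 1 "\<lambda>v. F (- v)" "- 1"] by simp
  finally show ?thesis by (simp add: o_def)
qed

theorem theorem2p2:
  fixes f g h ginv :: "real \<Rightarrow> real" and J J2 J3 :: "real set" and a b :: real
  assumes "g_convex_on J J2 J3 g f"
    and "h = g \<circ> f"
    and "ginv = inv_into J2 g"
    and "a \<in> J" and "b \<in> J" and "a < b"
  shows
    "(\<forall>v\<in>{0..1}. (h ((1 - v) * a + v * b) + h ((1 - v) * b + v * a)) / 2 \<in> g ` J2) \<and>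
     (\<forall>v\<in>{0..1}. (1 - v) * h a + v * h b \<in> g ` J2) \<and>
     (\<forall>v\<in>{0..1}. (1 - v) * h b + v * h a \<in> g ` J2) \<and>
     ((\<lambda>v. ginv ((h ((1 - v) * a + v * b) + h ((1 - v) * b + v * a)) / 2)) integrable_on {0..1}) \<and>
     ((\<lambda>v. f ((1 - v) * a + v * b)) integrable_on {0..1}) \<and>
     ((\<lambda>v. ginv ((1 - v) * h a + v * h b)) integrable_on {0..1}) \<and>
     ((\<lambda>v. ginv ((1 - v) * h b + v * h a)) integrable_on {0..1}) \<and>
     (f ((a + b) / 2)
       \<le> integral {0..1} (\<lambda>v. ginv ((h ((1 - v) * a + v * b) + h ((1 - v) * b + v * a)) / 2))) \<and>
     (integral {0..1} (\<lambda>v. ginv ((h ((1 - v) * a + v * b) + h ((1 - v) * b + v * a)) / 2))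
       \<le> integral {0..1} (\<lambda>v. f ((1 - v) * a + v * b))) \<and>
     (integral {0..1} (\<lambda>v. f ((1 - v) * a + v * b))
       \<le> 1 / 2 * (integral {0..1} (\<lambda>v. ginv ((1 - v) * h a + v * h b))
                + integral {0..1} (\<lambda>v. ginv ((1 - v) * h b + v * h a)))) \<and>
     (1 / 2 * (integral {0..1} (\<lambda>v. ginv ((1 - v) * h a + v * h b))
            + integral {0..1} (\<lambda>v. ginv ((1 - v) * h b + v * h a)))
       \<le> (f a + f b) / 2)"
proof -
  have J: "is_interval J" and maps: "f ` J \<subseteq> J2" and contf: "continuous_on J f"
    and sm: "strict_mono_on J2 g" and cc: "concave_on J2 g" and cv: "convex_on J h"
    and J2: "is_interval J2"
    using assms(1,2) by (auto simp: g_convex_on_def)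
  have ab: "{a..b} \<subseteq> J"
    using J \<open>a \<in> J\<close> \<open>b \<in> J\<close> by (meson atLeastAtMost_iff is_interval_1 subsetI)
  have inj: "inj_on g J2" using sm by (rule strict_mono_on_imp_inj_on)
  have gf: "ginv (h x) = f x" if "x \<in> J" for x
    using that maps inj by (simp add: assms(2,3) image_subset_iff)
  have hx: "h x = g (f x)" for x by (simp add: assms(2))
  \<comment> \<open>The image of \<open>J2\<close> under \<open>g\<close> need not be an interval,
    so convex combinations are kept inside the smaller set \<open>I\<close>, which is one.\<close>
  define I where "I = h ` {a..b}"
  have conth: "continuous_on {a..b} h"
    unfolding assms(2) using continuous_on_compose_g_convex[OF assms(1)] ab
    by (rule continuous_on_subset)
  have I_conv: "convex I"
    unfolding I_def using connected_continuous_image[OF conth connected_Icc] by (simp add: connected_convex_1)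
  have I_sub: "I \<subseteq> g ` J2" using ab maps by (auto simp: I_def hx)
  \<comment> \<open>The inverse undoes \<open>g\<close>, so this composition is \<open>f\<close> on
    \<open>{a..b}\<close>; continuity then descends through \<open>h\<close>.\<close>
  have "continuous_on {a..b} (ginv \<circ> h)"
    using continuous_on_subset[OF contf ab] ab gf
    by (subst continuous_on_cong[OF refl, of _ _ f]) (auto simp: subset_iff)
  then have contginv: "continuous_on I ginv"
    unfolding I_def by (intro continuous_on_factor_compact conth) auto
  \<comment> \<open>This bound and the next reduce comparing \<open>ginv w\<close> with
    \<open>y\<close> to comparing \<open>w\<close> with \<open>g y\<close>, so convexity of
    \<open>h\<close> and concavity of \<open>g\<close> can be used directly.\<close>
  have ginv_le: "ginv w \<le> y" if "w \<in> I" "y \<in> J2" "w \<le> g y" for w y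
    using that f_inv_into_f[of w g J2] inv_into_into[of w g J2] I_sub
    by (auto simp: assms(3) subset_iff simp flip: strict_mono_on_less_eq[OF sm])
  have ginv_ge: "y \<le> ginv w" if "w \<in> I" "y \<in> J2" "g y \<le> w" for w y
    using that f_inv_into_f[of w g J2] inv_into_into[of w g J2] I_sub
    by (auto simp: assms(3) subset_iff simp flip: strict_mono_on_less_eq[OF sm])

  define p where "p v = (1 - v) * a + v * b" for v
  have p_refl: "(1 - v) * b + v * a = p (1 - v)" for v by (simp add: p_def)
  have p_in: "p v \<in> {a..b}" if "v \<in> {0..1}" for v
    using that \<open>a < b\<close> convexD_alt[of "{a..b}" a b v]
    by (auto simp: p_def)
  have hp_in: "h (p v) \<in> I" if "v \<in> {0..1}" for v using p_in[OF that] by (simp add: I_def)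
  have fp_in: "f (p v) \<in> J2" if "v \<in> {0..1}" for v using p_in[OF that] ab maps by blast
  have ha: "h a \<in> I" and hb: "h b \<in> I" using \<open>a < b\<close> by (auto simp: I_def)
  have fa: "f a \<in> J2" and fb: "f b \<in> J2" using maps assms(4,5) by auto
  \<comment> \<open>\<open>A\<close> averages \<open>h\<close> over two points symmetric about the
    midpoint of \<open>{a..b}\<close>; \<open>B\<close> below is the chord of
    \<open>h\<close>.\<close>
  define A where "A v = (h (p v) + h (p (1 - v))) / 2" for v
  define B where "B v = (1 - v) * h a + v * h b" for v
  have B_refl: "(1 - v) * h b + v * h a = B (1 - v)" for v by (simp add: B_def)
  have A_in: "A v \<in> I" if "v \<in> {0..1}" for v
    using that convexD_alt[OF I_conv hp_in hp_in, of v "1 - v" "1/2"] by (simp add: A_def field_simps)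
  have B_in: "B v \<in> I" if "v \<in> {0..1}" for v
    using that convexD_alt[OF I_conv ha hb] by (simp add: B_def)

  have contp: "continuous_on {0..1} p" "continuous_on {0..1} (\<lambda>v. p (1 - v))"
    unfolding p_def by (intro continuous_intros)+
  have conthp: "continuous_on {0..1} (\<lambda>v. h (p v))" "continuous_on {0..1} (\<lambda>v. h (p (1 - v)))"
    using p_in by (auto intro!: continuous_on_compose2[OF conth] contp)
  have contA: "continuous_on {0..1} A"
    unfolding A_def by (intro continuous_intros conthp) auto
  have contB: "continuous_on {0..1} B" "continuous_on {0..1} (\<lambda>v. B (1 - v))"
    unfolding B_def by (intro continuous_intros)+
  have intA: "(\<lambda>v. ginv (A v)) integrable_on {0..1}"
    by (rule integrable_continuous_real) (use A_in in \<open>auto intro!: continuous_on_compose2[OF contginv] contA\<close>)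
  have intB: "(\<lambda>v. ginv (B v)) integrable_on {0..1}"
    by (rule integrable_continuous_real) (use B_in in \<open>auto intro!: continuous_on_compose2[OF contginv] contB\<close>)
  have intB': "(\<lambda>v. ginv (B (1 - v))) integrable_on {0..1}"
    by (rule integrable_continuous_real) (use B_in in \<open>auto intro!: continuous_on_compose2[OF contginv] contB\<close>)
  have intf: "(\<lambda>v. f (p v)) integrable_on {0..1}"
    by (rule integrable_continuous_real) (use p_in ab in \<open>auto intro!: continuous_on_compose2[OF contf] contp\<close>)
  have intf': "(\<lambda>v. f (p (1 - v))) integrable_on {0..1}"
    by (rule integrable_continuous_real) (use p_in ab in \<open>auto intro!: continuous_on_compose2[OF contf] contp\<close>)

  \<comment> \<open>For every \<open>v\<close> the points \<open>p v\<close> and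
    \<open>p (1 - v)\<close> have midpoint \<open>(a + b) / 2\<close>, so midpoint convexity of
    \<open>h\<close> applies.\<close>
  have 1: "f ((a + b) / 2) \<le> ginv (A v)" if v: "v \<in> {0..1}" for v
  proof (rule ginv_ge)
    have eq: "(1 - 1/2) *\<^sub>R p v + (1/2) *\<^sub>R p (1 - v) = (a + b) / 2"
      by (simp add: p_def field_simps)
    have "h ((1 - 1/2) *\<^sub>R p v + (1/2) *\<^sub>R p (1 - v)) \<le> (1 - 1/2) * h (p v) + (1/2) * h (p (1 - v))"
      using v p_in ab by (intro convex_onD[OF cv]) auto
    then show "g (f ((a + b) / 2)) \<le> A v" unfolding eq by (simp add: A_def hx)
    show "f ((a + b) / 2) \<in> J2" using \<open>a < b\<close> by (auto intro!: subsetD[OF maps] imageI subsetD[OF ab])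
  qed (rule A_in[OF v])
  \<comment> \<open>Midpoint concavity of \<open>g\<close> at the two values of \<open>f\<close>,
    whose mean stays in the interval \<open>J2\<close>.\<close>
  have 2: "ginv (A v) \<le> (f (p v) + f (p (1 - v))) / 2" if v: "v \<in> {0..1}" for v
  proof (rule ginv_le)
    have v': "1 - v \<in> {0..1}" using v by auto
    have eq: "(1 - 1/2) *\<^sub>R f (p v) + (1/2) *\<^sub>R f (p (1 - v)) = (f (p v) + f (p (1 - v))) / 2"
      by (simp add: field_simps)
    show "(f (p v) + f (p (1 - v))) / 2 \<in> J2"
      using convexD_alt[OF is_interval_convex[OF J2] fp_in[OF v] fp_in[OF v'], of "1/2"]
      unfolding eq by simp
    show "A v \<le> g ((f (p v) + f (p (1 - v))) / 2)"
      using concave_onD[OF cc _ _ fp_in[OF v] fp_in[OF v'], of "1/2"] unfolding eq by (simp add: A_def hx field_simps)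
  qed (rule A_in[OF v])
  have 3: "f (p v) \<le> ginv (B v)" if v: "v \<in> {0..1}" for v
  proof (rule ginv_ge)
    show "g (f (p v)) \<le> B v"
      using v convex_onD[OF cv _ _ assms(4,5), of v] by (simp add: p_def B_def hx)
  qed (use v fp_in B_in in auto)
  \<comment> \<open>By concavity, \<open>g\<close> applied to the chord of \<open>f\<close>
    dominates the chord \<open>B\<close> of \<open>g \<circ> f\<close>.\<close>
  have 4: "ginv (B v) \<le> (1 - v) * f a + v * f b" if v: "v \<in> {0..1}" for v
  proof (rule ginv_le)
    show "(1 - v) * f a + v * f b \<in> J2"
      using convexD_alt[OF is_interval_convex[OF J2] fa fb, of v] v by simp
    show "B v \<le> g ((1 - v) * f a + v * f b)"
      using v concave_onD[OF cc _ _ fa fb, of v] by (simp add: B_def hx)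
  qed (rule B_in[OF v])

  have reflf: "integral {0..1} (\<lambda>v. f (p (1 - v))) = integral {0..1} (\<lambda>v. f (p v))"
    by (rule integral_reflect_unit)
  have reflB: "integral {0..1} (\<lambda>v. ginv (B (1 - v))) = integral {0..1} (\<lambda>v. ginv (B v))"
    by (rule integral_reflect_unit)
  have "integral {0..1} (\<lambda>v::real. f ((a + b) / 2)) \<le> integral {0..1} (\<lambda>v. ginv (A v))"
    using 1 by (intro integral_le intA integrable_const_ivl) auto
  then have i1: "f ((a + b) / 2) \<le> integral {0..1} (\<lambda>v. ginv (A v))" by simp
  have "integral {0..1} (\<lambda>v. ginv (A v)) \<le> integral {0..1} (\<lambda>v. (f (p v) + f (p (1 - v))) / 2)"
    using 2 by (intro integral_le intA) (auto intro: integrable_add[OF intf intf'])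
  also have "\<dots> = integral {0..1} (\<lambda>v. f (p v))"
    by (simp add: integral_add[OF intf intf'] reflf)
  finally have i2: "integral {0..1} (\<lambda>v. ginv (A v)) \<le> integral {0..1} (\<lambda>v. f (p v))" .
  \<comment> \<open>One term suffices: by \<open>reflB\<close> the two integrals in the third bound
    coincide, so their mean is this one.\<close>
  have i3: "integral {0..1} (\<lambda>v. f (p v)) \<le> integral {0..1} (\<lambda>v. ginv (B v))"
    using 3 by (intro integral_le intf intB) auto
  have "integral {0..1} (\<lambda>v. ginv (B v)) + integral {0..1} (\<lambda>v. ginv (B (1 - v)))
      = integral {0..1} (\<lambda>v. ginv (B v) + ginv (B (1 - v)))"
    by (rule integral_add[OF intB intB', symmetric])
  \<comment> \<open>Adding the bounds at \<open>v\<close> and \<open>1 - v\<close> cancels the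
    weights and leaves a constant integrand.\<close>
  also have "\<dots> \<le> integral {0..1} (\<lambda>v::real. f a + f b)"
  proof (intro integral_le integrable_add intB intB' integrable_const_ivl)
    fix v :: real assume v: "v \<in> {0..1}"
    then have "1 - v \<in> {0..1}" by auto
    from 4[OF v] 4[OF this] show "ginv (B v) + ginv (B (1 - v)) \<le> f a + f b"
      by (simp add: algebra_simps)
  qed
  finally have i4: "integral {0..1} (\<lambda>v. ginv (B v)) + integral {0..1} (\<lambda>v. ginv (B (1 - v))) \<le> f a + f b"
    by simp

  have "B (1 - v) \<in> I" if "v \<in> {0..1}" for v using B_in[of "1 - v"] that by simp
  then show ?thesis
    \<comment> \<open>Folding goes from the inside out: \<open>A\<close> is expressed through
      \<open>p\<close>, so \<open>p\<close> must be in place first.\<close>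
    unfolding p_refl B_refl unfolding p_def[symmetric] unfolding A_def[symmetric] B_def[symmetric]
    using A_in B_in I_sub intA intB intB' intf i1 i2 i3 i4 reflB by (simp add: subset_iff)
qed

end
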